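(* For any $\mathcal{ALC}\iota$ concept $C$ (and, optionally, any $\mathcal{ALC}\iota$ ontology $\mathcal{O}$), if the tableau procedure $\mathtt{TAB}_{\mathcal{ALC}\iota}$ returns sat on input $C$ (resp. $C$ and $\mathcal{O}$), then $C$ is satisfiable (resp. satisfiable with respect to $\mathcal{O}$, i.e. $C^{\mathcal{I}}\neq\emptyset$ for some model $\mathcal{I}$ of $\mathcal{O}$).
   Context: $\mathcal{ALC}\iota$ concepts: $C ::= A \mid \neg C \mid (C\sqcap C) \mid \exists r.C \mid \{\iota C\} \mid \iota C.C$, semantics standard for $\neg,\sqcap,\exists r$; $(\{\iota C\})^{\mathcal{I}}=\{d\}$ if $C^{\mathcal{I}}=\{d\}$, else $\emptyset$; $(\iota C.D)^{\mathcal{I}}=\Delta^{\mathcal{I}}$ if $C^{\mathcal{I}}=\{d\}\subseteq D^{\mathcal{I}}$ for some $d$, else $\emptyset$. An ontology consists of a TBox (concept inclusions) and an ABox (assertions $a:C$, $r:(a,b)$). Procedure $\mathtt{TAB}_{\mathcal{ALC}\iota}$: builds a tree of assertions whose root contains $a:C$, $a$ not in $\mathcal{O}$. A branch (root-to-leaf path, treated as a set of assertions) is closed if it contains $\bot$, open otherwise. A rule $\frac{Pr}{Con_1\mid\cdots\mid Con_m}$ is applicable to $Pr$ if not blocked, no $Con_i$ is already on the branch, and the branch is open; applying it splits the branch into $m$ extensions. Rules are applied exhaustively ($(\bot)$ highest, $(\exists r)$ lowest priority); a branch is saturated if open with no applicable rule; output is sat if some open saturated branch exists, unsat if all branches close.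 Rules ($b,b'$ fresh individuals; $A^g_C$, $A_C$ fresh atomic concepts determined by $C$): $(ABox_{\mathsf I})$: if $a:C\in$ABox add $a:C$; $(ABox_r)$: if $r(a,a')\in$ABox add $r(a,a')$; $(TBox)$: from $C\sqsubseteq D\in$TBox and $a:E$ add $a:\neg(C\sqcap\neg D)$; $(\bot)$: $a:C,a:\neg C\Rightarrow\bot$; $(\neg\neg)$: $a:\neg\neg C\Rightarrow a:C$; $(\sqcap)$: $a:C\sqcap D\Rightarrow a:C,a:D$; $(\neg\sqcap)$: $a:\neg(C\sqcap D)\Rightarrow a:\neg C\mid a:\neg D$; $(\exists r)$: $a:\exists r.C\Rightarrow b:C,r:(a,b)$, blocked if some individual $a'$ on the branch has $a':C$ and $a':\neg D$ for every $D$ with $a:\neg\exists r.D$ on the branch; $(\neg\exists r)$: $a:\neg\exists r.C,r:(a,a')\Rightarrow a':\neg C$; $(\iota^g_1)$: $a:\iota C.D\Rightarrow b:C,b:D$, except that if some individual already satisfies $C$ only $D$ is added to the lexicographically least such; $(\iota^g_2)$: $a:\iota C.D,a':C,a'':C,a':E\Rightarrow a'':E$; $(\neg\iota^g)$: $a:\neg\iota C.D,a':E\Rightarrow a':\neg C\mid a':\neg D\mid b:C,b:A^g_C,b':C,b':\neg A^g_C$, and once the third alternative has been taken, further applications to $x:\neg\iota C.E$ are blocked; $(cut^g_\iota)$: $a:\iota C.D,a':E\Rightarrow a':C\mid a':\neg C$; $(\iota^\ell_1)$: $a:\{\iota C\}\Rightarrow a:C$; $(\iota^\ell_2)$: $a:\{\iota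 C\},a':C,a'':C,a':D\Rightarrow a'':D$; $(\neg\iota^\ell)$: $a:\neg\{\iota C\}\Rightarrow a:\neg C\mid a:\neg A_C,b:C,b:A_C$ (in the right alternative only $a:\neg A_C$ is added if an individual already satisfies $C$ and $A_C$); $(cut^\ell_\iota)$: $a:\{\iota C\},a':D\Rightarrow a':C\mid a':\neg C$.
   Formalization: In (TBox), (¬ι^g) and both cut rules, a premise a:E whose E is not used in the conclusion is read as "a occurs on the branch", in a concept or role assertion; read literally the claim fails, e.g. for ABox {r:(b,c)}, TBox {∃r.⊤ ⊑ ⊥}, C = A. *)

theory Defs
  imports Main
begin

section \<open>Syntax\<close>

text \<open>The linear order of \<^typ>\<open>String.literal\<close> is the lexicographic one.\<close>

type_synonym cname = String.literal
type_synonym rname = String.literal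
type_synonym iname = String.literal

datatype concept =
    Atom cname
  | Neg concept
  | Conj concept concept
  | Exists rname concept
  | LDesc concept            \<comment> \<open>\<open>{\<iota>C}\<close>\<close>
  | GDesc concept concept    \<comment> \<open>\<open>\<iota>C.D\<close>\<close>

datatype assertion =
    ConceptAssertion iname concept
  | RoleAssertion rname iname iname

record ontology =
  tbox :: "(concept \<times> concept) set"    \<comment> \<open>\<open>(C, D)\<close> stands for the inclusion of \<open>C\<close> in \<open>D\<close>\<close>
  abox :: "assertion set"

definition empty_ontology :: ontology where
  "empty_ontology = \<lparr>tbox = {}, abox = {}\<rparr>"

primrec atoms :: "concept \<Rightarrow> cname set" where
  "atoms (Atom A) = {A}"
| "atoms (Neg C) = atoms C"
| "atoms (Conj C D) = atoms C \<union> atoms D"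
| "atoms (Exists r C) = atoms C"
| "atoms (LDesc C) = atoms C"
| "atoms (GDesc C D) = atoms C \<union> atoms D"

primrec assertion_atoms :: "assertion \<Rightarrow> cname set" where
  "assertion_atoms (ConceptAssertion a C) = atoms C"
| "assertion_atoms (RoleAssertion r a b) = {}"

primrec assertion_inds :: "assertion \<Rightarrow> iname set" where
  "assertion_inds (ConceptAssertion a C) = {a}"
| "assertion_inds (RoleAssertion r a b) = {a, b}"

definition ontology_atoms :: "ontology \<Rightarrow> cname set" where
  "ontology_atoms \<O> = (\<Union>(C, D)\<in>tbox \<O>. atoms C \<union> atoms D) \<union> (\<Union>\<alpha>\<in>abox \<O>. assertion_atoms \<alpha>)"

definition ontology_inds :: "ontology \<Rightarrow> iname set" where
  "ontology_inds \<O> = (\<Union>\<alpha>\<in>abox \<O>. assertion_inds \<alpha>)"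


section \<open>Semantics\<close>

record 'd interp =
  dom :: "'d set"
  cint :: "cname \<Rightarrow> 'd set"
  rint :: "rname \<Rightarrow> ('d \<times> 'd) set"
  iint :: "iname \<Rightarrow> 'd"

definition interpretation_wf :: "'d interp \<Rightarrow> bool" where
  "interpretation_wf I \<longleftrightarrow>
     dom I \<noteq> {} \<and> (\<forall>A. cint I A \<subseteq> dom I) \<and> (\<forall>r. rint I r \<subseteq> dom I \<times> dom I) \<and> (\<forall>a. iint I a \<in> dom I)"

primrec ext :: "'d interp \<Rightarrow> concept \<Rightarrow> 'd set" where
  "ext I (Atom A) = cint I A"
| "ext I (Neg C) = dom I - ext I C"
| "ext I (Conj C D) = ext I C \<inter> ext I D"
| "ext I (Exists r C) = {d \<in> dom I. \<exists>e. (d, e) \<in> rint I r \<and> e \<in> ext I C}"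
| "ext I (LDesc C) = (if \<exists>d. ext I C = {d} then ext I C else {})"
| "ext I (GDesc C D) = (if \<exists>d. ext I C = {d} \<and> {d} \<subseteq> ext I D then dom I else {})"

primrec satisfies :: "'d interp \<Rightarrow> assertion \<Rightarrow> bool" where
  "satisfies I (ConceptAssertion a C) \<longleftrightarrow> iint I a \<in> ext I C"
| "satisfies I (RoleAssertion r a b) \<longleftrightarrow> (iint I a, iint I b) \<in> rint I r"

definition model_of :: "'d interp \<Rightarrow> ontology \<Rightarrow> bool" where
  "model_of I \<O> \<longleftrightarrow>
     interpretation_wf I \<and> (\<forall>(C, D)\<in>tbox \<O>. ext I C \<subseteq> ext I D) \<and> (\<forall>\<alpha>\<in>abox \<O>. satisfies I \<alpha>)"

text \<open>HOL cannot quantify existentially over the type of domain elements. Domains range over the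
  nonempty sets of natural numbers, so an interpretation obtained below is in particular one in the
  usual sense.\<close>

definition satisfiable :: "concept \<Rightarrow> bool" where
  "satisfiable C \<longleftrightarrow> (\<exists>I :: nat interp. interpretation_wf I \<and> ext I C \<noteq> {})"

definition satisfiable_wrt :: "ontology \<Rightarrow> concept \<Rightarrow> bool" where
  "satisfiable_wrt \<O> C \<longleftrightarrow> (\<exists>I :: nat interp. model_of I \<O> \<and> ext I C \<noteq> {})"


section \<open>The tableau procedure\<close>

datatype entry = Assertion assertion | Clash

type_synonym branch = "entry set"

abbreviation conc :: "iname \<Rightarrow> concept \<Rightarrow> entry" where
  "conc a C \<equiv> Assertion (ConceptAssertion a C)"

abbreviation role :: "rname \<Rightarrow> iname \<Rightarrow> iname \<Rightarrow> entry" where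
  "role r a b \<equiv> Assertion (RoleAssertion r a b)"

definition branch_inds :: "branch \<Rightarrow> iname set" where
  "branch_inds B = (\<Union>\<alpha>\<in>{\<alpha>. Assertion \<alpha> \<in> B}. assertion_inds \<alpha>)"

definition fresh :: "ontology \<Rightarrow> branch \<Rightarrow> iname \<Rightarrow> bool" where
  "fresh \<O> B b \<longleftrightarrow> b \<notin> branch_inds B \<and> b \<notin> ontology_inds \<O>"

text \<open>\<open>gm C\<close> and \<open>lm C\<close> are the fresh atomic concepts attached to \<open>C\<close> by the rules for negated
  global and negated local descriptions.\<close>

definition fresh_markers :: "ontology \<Rightarrow> concept \<Rightarrow> (concept \<Rightarrow> cname) \<Rightarrow> (concept \<Rightarrow> cname) \<Rightarrow> bool" where
  "fresh_markers \<O> C gm lm \<longleftrightarrow>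
     inj gm \<and> inj lm \<and> range gm \<inter> range lm = {} \<and>
     (range gm \<union> range lm) \<inter> (atoms C \<union> ontology_atoms \<O>) = {}"

datatype rule =
    ABoxI | ABoxR | TBoxRule | Bot | NegNeg | ConjRule | NegConj | ExRule | NegExRule
  | GIota1 | GIota2 | NegGIota | GCut | LIota1 | LIota2 | NegLIota | LCut

text \<open>\<open>rule_inst \<O> gm lm B \<rho> Ks\<close>: the premises of an instance of \<open>\<rho>\<close> are available on \<open>B\<close>, the instance
  is not blocked, and \<open>Ks\<close> lists its alternatives. A premise \<open>a:E\<close> whose concept \<open>E\<close> is not used in
  the conclusion only says that the individual is present; it is rendered by \<open>a \<in> branch_inds B\<close>, so
  that it also covers individuals of the ABox that occur in role assertions only.

  In \<open>NegGIota\<close>, that the third alternative has been taken for \<open>C\<close> can be read off the branch as a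
  set, because \<open>gm C\<close> is introduced by that alternative only.\<close>

inductive rule_inst ::
  "ontology \<Rightarrow> (concept \<Rightarrow> cname) \<Rightarrow> (concept \<Rightarrow> cname) \<Rightarrow> branch \<Rightarrow> rule \<Rightarrow> entry set list \<Rightarrow> bool"
  for \<O> gm lm B
where
  ABoxI: "ConceptAssertion a C \<in> abox \<O> \<Longrightarrow>
    rule_inst \<O> gm lm B ABoxI [{conc a C}]"
| ABoxR: "RoleAssertion r a a' \<in> abox \<O> \<Longrightarrow>
    rule_inst \<O> gm lm B ABoxR [{role r a a'}]"
| TBox: "(C, D) \<in> tbox \<O> \<Longrightarrow> a \<in> branch_inds B \<Longrightarrow>
    rule_inst \<O> gm lm B TBoxRule [{conc a (Neg (Conj C (Neg D)))}]"
| Bot: "conc a C \<in> B \<Longrightarrow> conc a (Neg C) \<in> B \<Longrightarrow>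
    rule_inst \<O> gm lm B Bot [{Clash}]"
| NegNeg: "conc a (Neg (Neg C)) \<in> B \<Longrightarrow>
    rule_inst \<O> gm lm B NegNeg [{conc a C}]"
| Conj: "conc a (Conj C D) \<in> B \<Longrightarrow>
    rule_inst \<O> gm lm B ConjRule [{conc a C, conc a D}]"
| NegConj: "conc a (Neg (Conj C D)) \<in> B \<Longrightarrow>
    rule_inst \<O> gm lm B NegConj [{conc a (Neg C)}, {conc a (Neg D)}]"
| Ex: "conc a (Exists r C) \<in> B \<Longrightarrow> fresh \<O> B b \<Longrightarrow>
    \<not> (\<exists>a'. conc a' C \<in> B \<and> (\<forall>D. conc a (Neg (Exists r D)) \<in> B \<longrightarrow> conc a' (Neg D) \<in> B)) \<Longrightarrow>
    rule_inst \<O> gm lm B ExRule [{conc b C, role r a b}]"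
| NegEx: "conc a (Neg (Exists r C)) \<in> B \<Longrightarrow> role r a a' \<in> B \<Longrightarrow>
    rule_inst \<O> gm lm B NegExRule [{conc a' (Neg C)}]"
| GIota1_new: "conc a (GDesc C D) \<in> B \<Longrightarrow> \<not> (\<exists>a'. conc a' C \<in> B) \<Longrightarrow> fresh \<O> B b \<Longrightarrow>
    rule_inst \<O> gm lm B GIota1 [{conc b C, conc b D}]"
| GIota1_old: "conc a (GDesc C D) \<in> B \<Longrightarrow> conc a' C \<in> B \<Longrightarrow>
    (\<And>a''. conc a'' C \<in> B \<Longrightarrow> a' \<le> a'') \<Longrightarrow>
    rule_inst \<O> gm lm B GIota1 [{conc a' D}]"
| GIota2: "conc a (GDesc C D) \<in> B \<Longrightarrow> conc a' C \<in> B \<Longrightarrow> conc a'' C \<in> B \<Longrightarrow> conc a' E \<in> B \<Longrightarrow>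
    rule_inst \<O> gm lm B GIota2 [{conc a'' E}]"
| NegGIota: "conc a (Neg (GDesc C D)) \<in> B \<Longrightarrow> a' \<in> branch_inds B \<Longrightarrow>
    fresh \<O> B b \<Longrightarrow> fresh \<O> B b' \<Longrightarrow> b \<noteq> b' \<Longrightarrow>
    \<not> (\<exists>x x'. conc x C \<in> B \<and> conc x (Atom (gm C)) \<in> B \<and>
              conc x' C \<in> B \<and> conc x' (Neg (Atom (gm C))) \<in> B) \<Longrightarrow>
    rule_inst \<O> gm lm B NegGIota
      [{conc a' (Neg C)}, {conc a' (Neg D)},
       {conc b C, conc b (Atom (gm C)), conc b' C, conc b' (Neg (Atom (gm C)))}]"
| GCut: "conc a (GDesc C D) \<in> B \<Longrightarrow> a' \<in> branch_inds B \<Longrightarrow>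
    rule_inst \<O> gm lm B GCut [{conc a' C}, {conc a' (Neg C)}]"
| LIota1: "conc a (LDesc C) \<in> B \<Longrightarrow>
    rule_inst \<O> gm lm B LIota1 [{conc a C}]"
| LIota2: "conc a (LDesc C) \<in> B \<Longrightarrow> conc a' C \<in> B \<Longrightarrow> conc a'' C \<in> B \<Longrightarrow> conc a' D \<in> B \<Longrightarrow>
    rule_inst \<O> gm lm B LIota2 [{conc a'' D}]"
| NegLIota_new: "conc a (Neg (LDesc C)) \<in> B \<Longrightarrow>
    \<not> (\<exists>x. conc x C \<in> B \<and> conc x (Atom (lm C)) \<in> B) \<Longrightarrow> fresh \<O> B b \<Longrightarrow>
    rule_inst \<O> gm lm B NegLIota
      [{conc a (Neg C)}, {conc a (Neg (Atom (lm C))), conc b C, conc b (Atom (lm C))}]"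
| NegLIota_old: "conc a (Neg (LDesc C)) \<in> B \<Longrightarrow>
    \<exists>x. conc x C \<in> B \<and> conc x (Atom (lm C)) \<in> B \<Longrightarrow>
    rule_inst \<O> gm lm B NegLIota [{conc a (Neg C)}, {conc a (Neg (Atom (lm C)))}]"
| LCut: "conc a (LDesc C) \<in> B \<Longrightarrow> a' \<in> branch_inds B \<Longrightarrow>
    rule_inst \<O> gm lm B LCut [{conc a' C}, {conc a' (Neg C)}]"

definition open_branch :: "branch \<Rightarrow> bool" where
  "open_branch B \<longleftrightarrow> Clash \<notin> B"

definition applicable ::
  "ontology \<Rightarrow> (concept \<Rightarrow> cname) \<Rightarrow> (concept \<Rightarrow> cname) \<Rightarrow> branch \<Rightarrow> rule \<Rightarrow> entry set list \<Rightarrow> bool" where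
  "applicable \<O> gm lm B \<rho> Ks \<longleftrightarrow>
     rule_inst \<O> gm lm B \<rho> Ks \<and> (\<forall>K\<in>set Ks. \<not> K \<subseteq> B) \<and> open_branch B"

definition saturated :: "ontology \<Rightarrow> (concept \<Rightarrow> cname) \<Rightarrow> (concept \<Rightarrow> cname) \<Rightarrow> branch \<Rightarrow> bool" where
  "saturated \<O> gm lm B \<longleftrightarrow> open_branch B \<and> (\<nexists>\<rho> Ks. applicable \<O> gm lm B \<rho> Ks)"

definition rank :: "rule \<Rightarrow> nat" where
  "rank \<rho> = (if \<rho> = Bot then 0 else if \<rho> = ExRule then 2 else 1)"

definition next_rule ::
  "ontology \<Rightarrow> (concept \<Rightarrow> cname) \<Rightarrow> (concept \<Rightarrow> cname) \<Rightarrow> branch \<Rightarrow> rule \<Rightarrow> entry set list \<Rightarrow> bool" where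
  "next_rule \<O> gm lm B \<rho> Ks \<longleftrightarrow>
     applicable \<O> gm lm B \<rho> Ks \<and> (\<forall>\<rho>' Ks'. applicable \<O> gm lm B \<rho>' Ks' \<longrightarrow> rank \<rho> \<le> rank \<rho>')"

datatype tree = Node (label: "entry set") (children: "tree list")

text \<open>A branch is the set of all entries on a path from the root to a leaf.\<close>

primrec branches :: "tree \<Rightarrow> branch set" where
  "branches (Node L ts) = (if ts = [] then {L} else (\<Union>X\<in>set (map branches ts). (\<union>) L ` X))"

text \<open>\<open>grown \<O> gm lm B t\<close>: \<open>t\<close> is produced by rule applications below a node whose path from the root,
  including the node itself, carries the entries \<open>B\<close>.\<close>

inductive grown :: "ontology \<Rightarrow> (concept \<Rightarrow> cname) \<Rightarrow> (concept \<Rightarrow> cname) \<Rightarrow> branch \<Rightarrow> tree \<Rightarrow> bool"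
  for \<O> gm lm
where
  leaf: "grown \<O> gm lm B (Node L [])"
| split: "next_rule \<O> gm lm B \<rho> Ks \<Longrightarrow>
    list_all2 (\<lambda>K t. label t = K \<and> grown \<O> gm lm (B \<union> K) t) Ks ts \<Longrightarrow>
    grown \<O> gm lm B (Node L ts)"

definition tableau ::
  "ontology \<Rightarrow> (concept \<Rightarrow> cname) \<Rightarrow> (concept \<Rightarrow> cname) \<Rightarrow> iname \<Rightarrow> concept \<Rightarrow> tree \<Rightarrow> bool" where
  "tableau \<O> gm lm a C t \<longleftrightarrow> label t = {conc a C} \<and> grown \<O> gm lm {conc a C} t"

text \<open>The choice of the fresh names and of the next rule among those of equal priority is left open;
  the procedure returns sat if some way of resolving these choices leads to an open saturated branch.\<close>

definition tab_returns_sat :: "ontology \<Rightarrow> concept \<Rightarrow> bool" where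
  "tab_returns_sat \<O> C \<longleftrightarrow>
     (\<exists>gm lm a t. fresh_markers \<O> C gm lm \<and> a \<notin> ontology_inds \<O> \<and> tableau \<O> gm lm a C t \<and>
        (\<exists>B\<in>branches t. saturated \<O> gm lm B))"

end

theory Submission
  imports Defs
begin

text \<open>An open saturated branch \<open>B\<close> is finite, so fresh individuals never run out and every
  generating rule that is not applicable must be blocked or already satisfied. A model is read off
  \<open>B\<close> by identifying individuals that satisfy the same concepts on \<open>B\<close>. The rules
  \<open>LIota2\<close> and \<open>GIota2\<close> together with the cut rules say that all individuals satisfying the
  description belong to one class, while the markers introduced for negated descriptions keep the
  witnesses of non-uniqueness in different classes. Roles are interpreted as largely as the negated
  existential restrictions on \<open>B\<close> permit, so that a blocked existential restriction is witnessed by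
  the blocking individual.\<close>

section \<open>Finiteness of branches\<close>

lemma rule_inst_finite:
  assumes "rule_inst \<O> gm lm B \<rho> Ks" "K \<in> set Ks"
  shows "finite K"
  using assms by cases auto

text \<open>Labels below the root are alternatives of rule instances, hence finite, and paths are
  finite. The inclusion later keeps the input assertion on the branch.\<close>

lemma grown_branches:
  assumes "grown \<O> gm lm B t" "finite (label t)" "X \<in> branches t"
  shows "finite X \<and> label t \<subseteq> X"
  using assms
proof (induction arbitrary: X rule: grown.induct)
  case (leaf B L)
  then show ?case by simp
next
  case (split B \<rho> Ks ts L)
  show ?case
  proof (cases "ts = []")
    case True
    then show ?thesis using split.prems by simp
  next
    case False
    then obtain t Y where t: "t \<in> set ts" "Y \<in> branches t" "X = L \<union> Y"
      using split.prems by auto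
    then obtain i where i: "i < length ts" "t = ts ! i"
      by (auto simp: in_set_conv_nth)
    then have len: "i < length Ks" and lab: "label t = Ks ! i"
      and IH: "finite (label t) \<Longrightarrow> Y \<in> branches t \<Longrightarrow> finite Y"
      using split.IH by (auto simp: list_all2_conv_all_nth)
    have "finite (label t)"
      using rule_inst_finite[of \<O> gm lm B \<rho> Ks "Ks ! i"] split.hyps len lab
      by (simp add: next_rule_def applicable_def)
    then show ?thesis using IH t split.prems by simp
  qed
qed

lemma ext_subset_dom: "interpretation_wf I \<Longrightarrow> ext I C \<subseteq> dom I"
  by (induction C) (auto simp: interpretation_wf_def)

lemma conc_branch_inds: "conc a C \<in> B \<Longrightarrow> a \<in> branch_inds B"
  unfolding branch_inds_def by force

lemma role_branch_inds: "role r a b \<in> B \<Longrightarrow> a \<in> branch_inds B \<and> b \<in> branch_inds B"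
  unfolding branch_inds_def by force

lemma finite_branch_inds: "finite B \<Longrightarrow> finite (branch_inds B)"
proof -
  assume "finite B"
  then have "finite (Assertion -` B)"
    by (rule finite_vimageI) (simp add: inj_def)
  moreover have "finite (assertion_inds \<alpha>)" for \<alpha>
    by (cases \<alpha>) auto
  ultimately show ?thesis
    by (simp add: branch_inds_def vimage_def)
qed

section \<open>Saturated branches\<close>

definition branch_label :: "branch \<Rightarrow> iname \<Rightarrow> concept set" where
  "branch_label B a = {C. conc a C \<in> B}"

text \<open>\<open>f\<close> codes the classes of individuals with equal labels as naturals, the
  domain type in \<open>satisfiable_wrt\<close>; \<open>a0\<close> supplies a value for names off
  the branch.\<close>

locale saturated_branch =
  fixes \<O> :: ontology and gm lm :: "concept \<Rightarrow> cname" and B :: branch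
    and f :: "iname \<Rightarrow> nat" and a0 :: iname
  assumes sat: "saturated \<O> gm lm B"
    and fin: "finite B"
    and a0: "a0 \<in> branch_inds B"
    and f_eq: "\<And>a b. f a = f b \<longleftrightarrow> branch_label B a = branch_label B b"
begin

text \<open>On an open branch, an instance fails to be applicable only because some alternative is
  already present. Saturation is used in this form for every rule.\<close>

lemma alternative:
  assumes "rule_inst \<O> gm lm B \<rho> Ks"
  obtains K where "K \<in> set Ks" "K \<subseteq> B"
  using assms sat unfolding saturated_def applicable_def by blast

lemma no_clash:
  assumes "conc a C \<in> B" "conc a (Neg C) \<in> B"
  shows False
  using alternative[OF rule_inst.Bot[OF assms]] sat
  by (auto simp: saturated_def open_branch_def)

lemma abox_subset: "\<alpha> \<in> abox \<O> \<Longrightarrow> Assertion \<alpha> \<in> B"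
  by (cases \<alpha>) (auto elim: alternative[OF rule_inst.ABoxI] alternative[OF rule_inst.ABoxR])

lemma fresh_iff: "fresh \<O> B b \<longleftrightarrow> b \<notin> branch_inds B"
  unfolding fresh_def using abox_subset by (auto simp: ontology_inds_def branch_inds_def)

lemma obtain_fresh:
  obtains b b' where "fresh \<O> B b" "fresh \<O> B b'" "b \<noteq> b'"
proof -
  have inf: "infinite (UNIV :: String.literal set)"
    by (rule infinite_literal)
  obtain b where b: "b \<notin> branch_inds B"
    using ex_new_if_finite[OF inf finite_branch_inds[OF fin]] by blast
  moreover obtain b' where "b' \<notin> insert b (branch_inds B)"
    using ex_new_if_finite[OF inf, of "insert b (branch_inds B)"] finite_branch_inds[OF fin] by blast
  ultimately show thesis using that fresh_iff by blast
qed

lemma fresh_not_conc: "fresh \<O> B b \<Longrightarrow> conc b C \<notin> B"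
  using conc_branch_inds by (auto simp: fresh_def)

lemma f_cong: "f a = f b \<Longrightarrow> conc a C \<in> B \<longleftrightarrow> conc b C \<in> B"
  by (auto simp: f_eq branch_label_def)

lemma f_eqI: "(\<And>C. conc a C \<in> B \<Longrightarrow> conc b C \<in> B) \<Longrightarrow> (\<And>C. conc b C \<in> B \<Longrightarrow> conc a C \<in> B)
    \<Longrightarrow> f a = f b"
  by (auto simp: f_eq branch_label_def)

section \<open>Canonical interpretation on classes of individuals\<close>

definition canonical :: "nat interp" where
  "canonical =
    \<lparr>dom = f ` branch_inds B,
     cint = (\<lambda>A. {f a | a. conc a (Atom A) \<in> B}),
     rint = (\<lambda>r. {(f a, f b) | a b. a \<in> branch_inds B \<and> b \<in> branch_inds B \<and>
       (\<forall>D. conc a (Neg (Exists r D)) \<in> B \<longrightarrow> conc b (Neg D) \<in> B)}),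
     iint = (\<lambda>a. f (if a \<in> branch_inds B then a else a0))\<rparr>"

lemma canonical_wf: "interpretation_wf canonical"
  using a0 by (auto simp: interpretation_wf_def canonical_def conc_branch_inds)

lemma dom_canonical: "dom canonical = f ` branch_inds B"
  by (simp add: canonical_def)

lemma iint_canonical: "a \<in> branch_inds B \<Longrightarrow> iint canonical a = f a"
  by (simp add: canonical_def)

lemma cint_canonical: "f a \<in> cint canonical A \<longleftrightarrow> conc a (Atom A) \<in> B"
  by (auto simp: canonical_def dest: f_cong)

lemma rint_canonicalI:
  assumes "a \<in> branch_inds B" "b \<in> branch_inds B"
    "\<And>D. conc a (Neg (Exists r D)) \<in> B \<Longrightarrow> conc b (Neg D) \<in> B"
  shows "(f a, f b) \<in> rint canonical r"
  using assms by (auto simp: canonical_def)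

text \<open>The pair may stem from another representative of the class of \<open>a\<close>, but by
  \<open>f_cong\<close> both carry the same negated restrictions.\<close>

lemma rint_canonicalE:
  assumes "(f a, e) \<in> rint canonical r"
  obtains b where "b \<in> branch_inds B" "e = f b"
    "\<And>D. conc a (Neg (Exists r D)) \<in> B \<Longrightarrow> conc b (Neg D) \<in> B"
  using assms by (auto simp: canonical_def dest: f_cong)

lemma ext_canonicalE:
  assumes "d \<in> ext canonical C"
  obtains a where "a \<in> branch_inds B" "d = f a"
  using assms ext_subset_dom[OF canonical_wf] by (auto simp: dom_canonical)

section \<open>Witnesses from existentials and descriptions\<close>

lemma ex_witness:
  assumes "conc a (Exists r C) \<in> B"
  obtains b where "conc b C \<in> B"
    "\<And>D. conc a (Neg (Exists r D)) \<in> B \<Longrightarrow> conc b (Neg D) \<in> B"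
proof -
  obtain b where b: "fresh \<O> B b" using obtain_fresh by blast
  show thesis
  proof (rule ccontr)
    assume "\<not> thesis"
    then have "\<not> (\<exists>a'. conc a' C \<in> B \<and> (\<forall>D. conc a (Neg (Exists r D)) \<in> B \<longrightarrow> conc a' (Neg D) \<in> B))"
      using that by blast
    \<comment> \<open>The only alternative mentions the fresh \<open>b\<close> and cannot be on the
      branch. So the blocking condition must hold, and the blocking individual is the
      witness.\<close>
    from alternative[OF rule_inst.Ex[OF assms b this]] show False
      using fresh_not_conc[OF b] by auto
  qed
qed

text \<open>Either an individual carrying the marker \<open>lm C\<close> exists, and
  \<open>a\<close> lacks \<open>C\<close> or is separated from it by the negated marker; or the
  right alternative of the rule needs a fresh individual and only \<open>Neg C\<close>
  remains.\<close>

lemma neg_ldesc: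
  assumes "conc a (Neg (LDesc C)) \<in> B"
  shows "conc a (Neg C) \<in> B \<or> (\<exists>x. conc x C \<in> B \<and> f x \<noteq> f a)"
proof (cases "\<exists>x. conc x C \<in> B \<and> conc x (Atom (lm C)) \<in> B")
  case True
  then obtain x where x: "conc x C \<in> B" "conc x (Atom (lm C)) \<in> B" by blast
  have "conc a (Neg C) \<in> B \<or> conc a (Neg (Atom (lm C))) \<in> B"
    by (rule alternative[OF rule_inst.NegLIota_old[where lm = lm, OF assms True]]) auto
  then show ?thesis using x no_clash f_cong by blast
next
  case False
  obtain b where b: "fresh \<O> B b" using obtain_fresh by blast
  show ?thesis
    by (rule alternative[OF rule_inst.NegLIota_new[where lm = lm, OF assms False b]])
      (use fresh_not_conc[OF b] in auto)
qed

text \<open>The cases are whether the third alternative has been taken. If so, the marker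
  \<open>gm C\<close> separates two instances of \<open>C\<close>; if not, that alternative names
  fresh individuals, so one of the other two is present at each individual.\<close>

lemma neg_gdesc:
  assumes "conc a (Neg (GDesc C D)) \<in> B"
  shows "(\<exists>x y. conc x C \<in> B \<and> conc y C \<in> B \<and> f x \<noteq> f y) \<or>
    (\<forall>a'\<in>branch_inds B. conc a' (Neg C) \<in> B \<or> conc a' (Neg D) \<in> B)"
proof (cases "\<exists>x x'. conc x C \<in> B \<and> conc x (Atom (gm C)) \<in> B \<and>
              conc x' C \<in> B \<and> conc x' (Neg (Atom (gm C))) \<in> B")
  case True
  then show ?thesis using no_clash f_cong by blast
next
  case False
  obtain b b' where b: "fresh \<O> B b" "fresh \<O> B b'" "b \<noteq> b'" by (rule obtain_fresh)
  have "conc a' (Neg C) \<in> B \<or> conc a' (Neg D) \<in> B" if "a' \<in> branch_inds B" for a'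
    by (rule alternative[OF rule_inst.NegGIota[where gm = gm, OF assms that b False]])
      (use fresh_not_conc[OF b(1)] in auto)
  then show ?thesis by blast
qed

lemma gdesc_witness:
  assumes "conc a (GDesc C D) \<in> B"
  obtains b where "conc b C \<in> B" "conc b D \<in> B"
proof -
  let ?S = "{x. conc x C \<in> B}"
  have ex: "\<exists>a'. conc a' C \<in> B"
  proof (rule ccontr)
    assume no: "\<not> ?thesis"
    obtain b where b: "fresh \<O> B b" using obtain_fresh by blast
    from alternative[OF rule_inst.GIota1_new[OF assms no b]] no show False by auto
  qed
  \<comment> \<open>Finiteness yields the lexicographically least instance of \<open>C\<close>, the
    one to which the rule adds \<open>D\<close>.\<close>
  have "?S \<subseteq> branch_inds B" using conc_branch_inds by blast
  then have "finite ?S" using finite_branch_inds[OF fin] finite_subset by blast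
  then have min: "Min ?S \<in> ?S" "\<And>x. x \<in> ?S \<Longrightarrow> Min ?S \<le> x"
    using ex Min_in[of ?S] by auto
  then have "conc (Min ?S) C \<in> B" by simp
  moreover from alternative[OF rule_inst.GIota1_old[OF assms this]] min(2)
  have "conc (Min ?S) D \<in> B" by auto
  ultimately show thesis by (rule that)
qed

section \<open>Truth lemma\<close>

lemma canonical_truth:
  "(conc a C \<in> B \<longrightarrow> f a \<in> ext canonical C) \<and> (conc a (Neg C) \<in> B \<longrightarrow> f a \<notin> ext canonical C)"
\<comment> \<open>Both polarities go together: negation swaps them, and the cut arguments use the
  negative one. Only implications hold in general, as a branch need not decide every
  concept.\<close>
proof (induction C arbitrary: a)
  case (Atom A)
  then show ?case using no_clash by (auto simp: cint_canonical)
next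
  case (Neg C)
  have "conc a C \<in> B" if "conc a (Neg (Neg C)) \<in> B"
    by (rule alternative[OF rule_inst.NegNeg[OF that]]) auto
  then show ?case using Neg.IH conc_branch_inds by (auto simp: dom_canonical)
next
  case (Conj C D)
  have "conc a C \<in> B \<and> conc a D \<in> B" if "conc a (Conj C D) \<in> B"
    by (rule alternative[OF rule_inst.Conj[OF that]]) auto
  moreover have "conc a (Neg C) \<in> B \<or> conc a (Neg D) \<in> B" if "conc a (Neg (Conj C D)) \<in> B"
    by (rule alternative[OF rule_inst.NegConj[OF that]]) auto
  ultimately show ?case using Conj.IH by auto
next
  case (Exists r C)
  have "f a \<in> ext canonical (Exists r C)" if ex: "conc a (Exists r C) \<in> B"
  proof -
    obtain b where b: "conc b C \<in> B"
        "\<And>D. conc a (Neg (Exists r D)) \<in> B \<Longrightarrow> conc b (Neg D) \<in> B"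
      using ex_witness[OF ex] by blast
    have "(f a, f b) \<in> rint canonical r"
      using b conc_branch_inds ex by (blast intro: rint_canonicalI)
    then show ?thesis using b(1) Exists.IH conc_branch_inds[OF ex] by (auto simp: dom_canonical)
  qed
  \<comment> \<open>Negated restrictions are built into the roles: every successor class has a
    representative carrying \<open>Neg C\<close>.\<close>
  moreover have "f a \<notin> ext canonical (Exists r C)" if "conc a (Neg (Exists r C)) \<in> B"
    using that Exists.IH by (auto elim!: rint_canonicalE)
  ultimately show ?case by blast
next
  case (LDesc C)
  have "f a \<in> ext canonical (LDesc C)" if l: "conc a (LDesc C) \<in> B"
  proof -
    have aC: "conc a C \<in> B"
      by (rule alternative[OF rule_inst.LIota1[OF l]]) auto
    have "d = f a" if d: "d \<in> ext canonical C" for d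
    proof -
      obtain b where b: "b \<in> branch_inds B" "d = f b" using d by (rule ext_canonicalE)
      \<comment> \<open>The cut supplies the converse of the truth claim for \<open>C\<close>:
        semantic membership rules out \<open>Neg C\<close>, so \<open>C\<close> itself is on the
        branch at \<open>b\<close>.\<close>
      have "conc b C \<in> B \<or> conc b (Neg C) \<in> B"
        by (rule alternative[OF rule_inst.LCut[OF l b(1)]]) auto
      then have bC: "conc b C \<in> B" using LDesc.IH d b by blast
      \<comment> \<open>Copying concepts in both directions makes the two labels equal.\<close>
      have "f b = f a"
        by (rule f_eqI) (auto elim: alternative[OF rule_inst.LIota2[OF l aC bC]]
            alternative[OF rule_inst.LIota2[OF l bC aC]])
      then show ?thesis using b by simp
    qed
    then have "ext canonical C = {f a}" using LDesc.IH aC by blast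
    then show ?thesis by simp
  qed
  moreover have "f a \<notin> ext canonical (LDesc C)" if "conc a (Neg (LDesc C)) \<in> B"
    using neg_ldesc[OF that] LDesc.IH by auto
  ultimately show ?case by blast
next
  case (GDesc C D)
  have "f a \<in> ext canonical (GDesc C D)" if g: "conc a (GDesc C D) \<in> B"
  proof -
    \<comment> \<open>Unlike in the local case, \<open>a\<close> need not satisfy \<open>C\<close>;
      \<open>x\<close> takes its place as the unique instance.\<close>
    obtain x where x: "conc x C \<in> B" "conc x D \<in> B" using gdesc_witness[OF g] by blast
    have "d = f x" if d: "d \<in> ext canonical C" for d
    proof -
      obtain b where b: "b \<in> branch_inds B" "d = f b" using d by (rule ext_canonicalE)
      have "conc b C \<in> B \<or> conc b (Neg C) \<in> B"
        by (rule alternative[OF rule_inst.GCut[OF g b(1)]]) auto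
      then have bC: "conc b C \<in> B" using GDesc.IH(1) d b by blast
      have "f b = f x"
        by (rule f_eqI) (auto elim: alternative[OF rule_inst.GIota2[OF g x(1) bC]]
            alternative[OF rule_inst.GIota2[OF g bC x(1)]])
      then show ?thesis using b by simp
    qed
    then have "ext canonical C = {f x}" using GDesc.IH(1) x by blast
    then show ?thesis using GDesc.IH(2) x conc_branch_inds[OF g] by (simp add: dom_canonical)
  qed
  moreover have "f a \<notin> ext canonical (GDesc C D)" if n: "conc a (Neg (GDesc C D)) \<in> B"
  proof
    assume "f a \<in> ext canonical (GDesc C D)"
    then obtain d where d: "ext canonical C = {d}" "d \<in> ext canonical D"
      by (auto split: if_splits)
    then obtain b where b: "b \<in> branch_inds B" "d = f b"
      using ext_canonicalE[of d C] by blast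
    \<comment> \<open>Two separated instances contradict the singleton extension; otherwise
      \<open>b\<close>, whose class lies in both extensions, carries \<open>Neg C\<close> or
      \<open>Neg D\<close>.\<close>
    show False using neg_gdesc[OF n]
    proof
      assume "\<exists>x y. conc x C \<in> B \<and> conc y C \<in> B \<and> f x \<noteq> f y"
      then show False using GDesc.IH(1) d(1) by (metis singletonD)
    next
      assume "\<forall>a'\<in>branch_inds B. conc a' (Neg C) \<in> B \<or> conc a' (Neg D) \<in> B"
      then show False using GDesc.IH d b by blast
    qed
  qed
  ultimately show ?case by blast
qed

section \<open>Model of the ontology and soundness\<close>

lemma canonical_model: "model_of canonical \<O>"
proof -
  have "ext canonical C \<subseteq> ext canonical D" if CD: "(C, D) \<in> tbox \<O>" for C D
  proof
    fix d assume d: "d \<in> ext canonical C"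
    then obtain a where a: "a \<in> branch_inds B" "d = f a" by (rule ext_canonicalE)
    have "conc a (Neg (Conj C (Neg D))) \<in> B"
      by (rule alternative[OF rule_inst.TBox[OF CD a(1)]]) auto
    then have "f a \<notin> ext canonical (Conj C (Neg D))" using canonical_truth by blast
    then show "d \<in> ext canonical D" using d a by (auto simp: dom_canonical)
  qed
  moreover have "satisfies canonical \<alpha>" if "\<alpha> \<in> abox \<O>" for \<alpha>
  proof (cases \<alpha>)
    case (ConceptAssertion a C)
    then have "conc a C \<in> B" using that abox_subset by blast
    then show ?thesis using ConceptAssertion canonical_truth conc_branch_inds
      by (simp add: iint_canonical)
  next
    case (RoleAssertion r a b)
    then have ab: "role r a b \<in> B" using that abox_subset by blast
    \<comment> \<open>Roles are not read off the role assertions, so a pair from the ABox must be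
      shown to respect the negated restrictions.\<close>
    have "conc b (Neg D) \<in> B" if "conc a (Neg (Exists r D)) \<in> B" for D
      by (rule alternative[OF rule_inst.NegEx[OF that ab]]) auto
    then have "(f a, f b) \<in> rint canonical r"
      using role_branch_inds[OF ab] by (blast intro: rint_canonicalI)
    then show ?thesis using RoleAssertion role_branch_inds[OF ab] by (simp add: iint_canonical)
  qed
  ultimately show ?thesis using canonical_wf by (auto simp: model_of_def)
qed

end

lemma tab_sound:
  assumes "tab_returns_sat \<O> C"
  shows "satisfiable_wrt \<O> C"
proof -
  obtain gm lm a t B where t: "tableau \<O> gm lm a C t" and B: "B \<in> branches t"
    and sat: "saturated \<O> gm lm B"
    using assms by (auto simp: tab_returns_sat_def)
  then have fin: "finite B" and aC: "conc a C \<in> B"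
    using grown_branches[of \<O> gm lm "{conc a C}" t B] by (auto simp: tableau_def)
  \<comment> \<open>All names off the branch share the empty label, so there are finitely many
    labels and they embed into the naturals.\<close>
  have "branch_label B x \<in> insert {} (branch_label B ` branch_inds B)" for x
  proof (cases "x \<in> branch_inds B")
    case False
    then have "branch_label B x = {}"
      using conc_branch_inds by (auto simp: branch_label_def)
    then show ?thesis by simp
  qed simp
  then have "range (branch_label B) \<subseteq> insert {} (branch_label B ` branch_inds B)"
    by blast
  then have "finite (range (branch_label B))"
    by (rule finite_subset) (simp add: finite_branch_inds[OF fin])
  then obtain h :: "concept set \<Rightarrow> nat" where "inj_on h (range (branch_label B))"
    using finite_imp_inj_to_nat_seg by blast
  \<comment> \<open>The input individual \<open>a\<close> serves as the default
    \<open>a0\<close>.\<close>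
  then interpret saturated_branch \<O> gm lm B "\<lambda>x. h (branch_label B x)" a
    by unfold_locales (use sat fin conc_branch_inds[OF aC] in \<open>simp_all add: inj_on_eq_iff\<close>)
  have "ext canonical C \<noteq> {}" using canonical_truth aC by blast
  then show ?thesis using canonical_model by (auto simp: satisfiable_wrt_def)
qed

theorem theorem7:
  fixes C :: concept and \<O> :: ontology
  shows "(tab_returns_sat empty_ontology C \<longrightarrow> satisfiable C) \<and>
         (tab_returns_sat \<O> C \<longrightarrow> satisfiable_wrt \<O> C)"
  using tab_sound[of empty_ontology C] tab_sound[of \<O> C]
  by (auto simp: satisfiable_def satisfiable_wrt_def model_of_def)

end
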